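(* (1) Let $(\boldsymbol{x},\boldsymbol{n},\boldsymbol{s}):U\to H^3\times\Delta_5$ be a hyperbolic framed surface with basic invariants $a_i,b_i,e_i,f_i,g_i$, $i=1,2$. Then $(\boldsymbol{x},\boldsymbol{n},\boldsymbol{s})$ is a hyperbolic generalized framed surface with $\alpha(u,v)=(a_1b_2-a_2b_1)(u,v)$ and $\beta(u,v)=0$. (2) Let $(\boldsymbol{x},\boldsymbol{\nu}_1,\boldsymbol{\nu}_2):U\to H^3\times\Delta_5$ be a hyperbolic generalized framed surface with basic invariants $a_i,b_i,c_i,e_i,f_i,g_i$, $i=1,2$. (i) If $a_1(u,v)=a_2(u,v)=0$ for all $(u,v)\in U$, then $(\boldsymbol{x},\boldsymbol{\nu}_1,\boldsymbol{\nu}_2)$ is a hyperbolic framed surface. (ii) If $b_1(u,v)=b_2(u,v)=0$ for all $(u,v)\in U$, then $(\boldsymbol{x},\boldsymbol{\nu}_2,\boldsymbol{\nu}_1)$ is a hyperbolic framed surface.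
   Context: $\mathbb{R}^4_1$ is $\mathbb{R}^4$ with the pseudo inner product $\langle \boldsymbol{x},\boldsymbol{y}\rangle=-x_1y_1+x_2y_2+x_3y_3+x_4y_4$. The pseudo vector product $\boldsymbol{x}\wedge\boldsymbol{y}\wedge\boldsymbol{z}$ of three vectors of $\mathbb{R}^4_1$ is the unique vector with $\langle \boldsymbol{w},\boldsymbol{x}\wedge\boldsymbol{y}\wedge\boldsymbol{z}\rangle=\det(\boldsymbol{w},\boldsymbol{x},\boldsymbol{y},\boldsymbol{z})$ for all $\boldsymbol{w}\in\mathbb{R}^4_1$. $H^3=\{\boldsymbol{x}\in\mathbb{R}^4_1: \langle\boldsymbol{x},\boldsymbol{x}\rangle=-1,\ x_1>0\}$, $S^3_1=\{\boldsymbol{x}\in\mathbb{R}^4_1:\langle\boldsymbol{x},\boldsymbol{x}\rangle=1\}$, $\Delta_5=\{(\boldsymbol{\nu}_1,\boldsymbol{\nu}_2)\in S^3_1\times S^3_1:\langle\boldsymbol{\nu}_1,\boldsymbol{\nu}_2\rangle=0\}$. $U$ is a simply connected open subset of $\mathbb{R}^2$ with coordinates $(u,v)$; subscripts $u,v$ denote partial derivatives; all maps are $C^\infty$. Hyperbolic framed surface: a smooth map $(\boldsymbol{x},\boldsymbol{n},\boldsymbol{s}):U\to H^3\times\Delta_5$ with $\langle\boldsymbol{x}_u,\boldsymbol{n}\rangle=\langle\boldsymbol{x}_v,\boldsymbol{n}\rangle=\langle\boldsymbol{x},\boldsymbol{n}\rangle=\langle\boldsymbol{x},\boldsymbol{s}\rangle=0$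 on $U$. With $\boldsymbol{t}=\boldsymbol{x}\wedge\boldsymbol{n}\wedge\boldsymbol{s}$, its basic invariants are the smooth functions given by $\boldsymbol{x}_u=a_1\boldsymbol{s}+b_1\boldsymbol{t}$, $\boldsymbol{n}_u=e_1\boldsymbol{s}+f_1\boldsymbol{t}$, $\boldsymbol{s}_u=a_1\boldsymbol{x}-e_1\boldsymbol{n}+g_1\boldsymbol{t}$, $\boldsymbol{t}_u=b_1\boldsymbol{x}-f_1\boldsymbol{n}-g_1\boldsymbol{s}$, and the same formulas with $u$ replaced by $v$ and index $1$ by $2$. Hyperbolic generalized framed surface: a smooth map $(\boldsymbol{x},\boldsymbol{\nu}_1,\boldsymbol{\nu}_2):U\to H^3\times\Delta_5$ with $\langle\boldsymbol{x},\boldsymbol{\nu}_1\rangle=\langle\boldsymbol{x},\boldsymbol{\nu}_2\rangle=0$ on $U$ for which there are smooth functions $\alpha,\beta:U\to\mathbb{R}$ with $\boldsymbol{x}\wedge\boldsymbol{x}_u\wedge\boldsymbol{x}_v=\alpha\boldsymbol{\nu}_1+\beta\boldsymbol{\nu}_2$ on $U$. "With $\alpha=\dots,\beta=\dots$" refers to these functions. With $\boldsymbol{\nu}_3=\boldsymbol{x}\wedge\boldsymbol{\nu}_1\wedge\boldsymbol{\nu}_2$, its basic invariants are the smooth functions given by $\boldsymbol{x}_u=a_1\boldsymbol{\nu}_1+b_1\boldsymbol{\nu}_2+c_1\boldsymbol{\nu}_3$, $\boldsymbol{\nu}_{1u}=a_1\boldsymbol{x}+e_1\boldsymbol{\nu}_2+f_1\boldsymbol{\nu}_3$,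 $\boldsymbol{\nu}_{2u}=b_1\boldsymbol{x}-e_1\boldsymbol{\nu}_1+g_1\boldsymbol{\nu}_3$, $\boldsymbol{\nu}_{3u}=c_1\boldsymbol{x}-f_1\boldsymbol{\nu}_1-g_1\boldsymbol{\nu}_2$, and the same formulas with $u$ replaced by $v$ and index $1$ by $2$. *)

theory Defs
  imports "HOL-Analysis.Analysis"
begin

section \<open>Minkowski space\<close>

definition mink :: "real^4 \<Rightarrow> real^4 \<Rightarrow> real"  (infixl \<open>\<star>\<close> 70)
  where "x \<star> y = - (x $ 1 * y $ 1) + x $ 2 * y $ 2 + x $ 3 * y $ 3 + x $ 4 * y $ 4"

text \<open>The arguments of the determinant are the rows of the matrix; taking them as columns gives
  the same number. Existence and uniqueness of the vector are shown in \<open>wedge_ex1\<close>.\<close>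

definition wedge :: "real^4 \<Rightarrow> real^4 \<Rightarrow> real^4 \<Rightarrow> real^4"
  where "wedge x y z = (THE p. \<forall>w. w \<star> p = det (vector [w, x, y, z] :: real^4^4))"

lemma vector_4:
  "(vector [a, b, c, d] :: 'a::zero^4) $ 1 = a"
  "(vector [a, b, c, d] :: 'a::zero^4) $ 2 = b"
  "(vector [a, b, c, d] :: 'a::zero^4) $ 3 = c"
  "(vector [a, b, c, d] :: 'a::zero^4) $ 4 = d"
  by (simp_all add: vector_def)

lemma wedge_ex1: "\<exists>!p. \<forall>w. w \<star> p = det (vector [w, x, y, z] :: real^4^4)"
proof -
  define r where "r i = (if i = 2 then x else if i = 3 then y else z)" for i :: 4
  define D where "D w = det (\<chi> i. if i = (1::4) then w else r i)" for w :: "real^4"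
  have vec: "det (vector [w, x, y, z] :: real^4^4) = D w" for w
  proof -
    have "(vector [w, x, y, z] :: real^4^4) = (\<chi> i. if i = 1 then w else r i)"
      by (simp add: vec_eq_iff forall_4 r_def vector_4)
    then show ?thesis by (simp add: D_def)
  qed
  have add: "D (v + w) = D v + D w" for v w
    unfolding D_def by (rule det_row_add)
  have scale: "D (c *s w) = c * D w" for c w
    unfolding D_def by (rule det_row_mul)
  have expand: "D w = w $ 1 * D (axis 1 1) + w $ 2 * D (axis 2 1) + w $ 3 * D (axis 3 1)
      + w $ 4 * D (axis 4 1)" for w
  proof -
    have "w = w $ 1 *s axis 1 1 + w $ 2 *s axis 2 1 + w $ 3 *s axis 3 1 + w $ 4 *s axis 4 1"
      by (simp add: vec_eq_iff forall_4 axis_def)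
    then have "D w = D (w $ 1 *s axis 1 1 + w $ 2 *s axis 2 1 + w $ 3 *s axis 3 1
      + w $ 4 *s axis 4 1)" by (rule arg_cong)
    then show ?thesis by (simp only: add scale)
  qed
  show ?thesis
  proof (rule ex1I)
    show "\<forall>w. w \<star> vector [- D (axis 1 1), D (axis 2 1), D (axis 3 1), D (axis 4 1)]
        = det (vector [w, x, y, z] :: real^4^4)"
      unfolding vec by (subst expand) (simp add: mink_def vector_4)
  next
    fix p assume p: "\<forall>w. w \<star> p = det (vector [w, x, y, z] :: real^4^4)"
    have "axis i 1 \<star> p = D (axis i 1)" for i
      using p vec by simp
    from this[of 1] this[of 2] this[of 3] this[of 4]
    show "p = vector [- D (axis 1 1), D (axis 2 1), D (axis 3 1), D (axis 4 1)]"
      by (simp add: vec_eq_iff forall_4 vector_4 mink_def axis_def)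
  qed
qed

definition H3 :: "(real^4) set"
  where "H3 = {x. x \<star> x = -1 \<and> x $ 1 > 0}"

definition S31 :: "(real^4) set"
  where "S31 = {x. x \<star> x = 1}"

definition Delta5 :: "((real^4) \<times> (real^4)) set"
  where "Delta5 = {(m, n). m \<in> S31 \<and> n \<in> S31 \<and> m \<star> n = 0}"


section \<open>Partial derivatives and smooth maps\<close>

text \<open>A point \<open>(u, v)\<close> is the vector with components \<open>p $ 1 = u\<close> and \<open>p $ 2 = v\<close>, so
  \<open>partial 1\<close> and \<open>partial 2\<close> are the derivatives with respect to \<open>u\<close> and \<open>v\<close>.\<close>

definition partial :: "2 \<Rightarrow> (real^2 \<Rightarrow> 'a::real_normed_vector) \<Rightarrow> real^2 \<Rightarrow> 'a"
  where "partial i f p = vector_derivative (\<lambda>h. f (p + h *\<^sub>R axis i 1)) (at 0)"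

text \<open>\<open>Ck_on k U f\<close> is meant for open \<open>U\<close>. Differentiability is required at each stage because
  \<open>partial\<close> returns an arbitrary value where the derivative does not exist.\<close>

primrec Ck_on :: "nat \<Rightarrow> (real^2) set \<Rightarrow> (real^2 \<Rightarrow> 'a::real_normed_vector) \<Rightarrow> bool"
  where
    "Ck_on 0 U f \<longleftrightarrow> continuous_on U f"
  | "Ck_on (Suc k) U f \<longleftrightarrow> (\<forall>p\<in>U. f differentiable (at p)) \<and> (\<forall>i. Ck_on k U (partial i f))"

definition smooth_on :: "(real^2) set \<Rightarrow> (real^2 \<Rightarrow> 'a::real_normed_vector) \<Rightarrow> bool"
  where "smooth_on U f \<longleftrightarrow> (\<forall>k. Ck_on k U f)"

definition smooth_H3_Delta5 ::
    "(real^2) set \<Rightarrow> (real^2 \<Rightarrow> real^4) \<Rightarrow> (real^2 \<Rightarrow> real^4) \<Rightarrow> (real^2 \<Rightarrow> real^4) \<Rightarrow> bool"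
  where "smooth_H3_Delta5 U x m n \<longleftrightarrow>
    smooth_on U x \<and> smooth_on U m \<and> smooth_on U n \<and>
    (\<forall>p\<in>U. (x p, (m p, n p)) \<in> H3 \<times> Delta5)"


section \<open>Hyperbolic framed surfaces\<close>

definition hyp_framed_surface ::
    "(real^2) set \<Rightarrow> (real^2 \<Rightarrow> real^4) \<Rightarrow> (real^2 \<Rightarrow> real^4) \<Rightarrow> (real^2 \<Rightarrow> real^4) \<Rightarrow> bool"
  where "hyp_framed_surface U x n s \<longleftrightarrow>
    smooth_H3_Delta5 U x n s \<and>
    (\<forall>p\<in>U. partial 1 x p \<star> n p = 0 \<and> partial 2 x p \<star> n p = 0 \<and>
           x p \<star> n p = 0 \<and> x p \<star> s p = 0)"

text \<open>The invariants are families indexed by \<open>i :: 2\<close>; as with \<open>partial\<close>, the index \<open>1\<close> belongs to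
  \<open>u\<close> and the index \<open>2\<close> to \<open>v\<close>.\<close>

definition hyp_framed_invariants ::
    "(real^2) set \<Rightarrow> (real^2 \<Rightarrow> real^4) \<Rightarrow> (real^2 \<Rightarrow> real^4) \<Rightarrow> (real^2 \<Rightarrow> real^4) \<Rightarrow>
     (2 \<Rightarrow> real^2 \<Rightarrow> real) \<Rightarrow> (2 \<Rightarrow> real^2 \<Rightarrow> real) \<Rightarrow> (2 \<Rightarrow> real^2 \<Rightarrow> real) \<Rightarrow>
     (2 \<Rightarrow> real^2 \<Rightarrow> real) \<Rightarrow> (2 \<Rightarrow> real^2 \<Rightarrow> real) \<Rightarrow> bool"
  where "hyp_framed_invariants U x n s a b e f g \<longleftrightarrow>
    (let t = (\<lambda>p. wedge (x p) (n p) (s p)) in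
     \<forall>i. smooth_on U (a i) \<and> smooth_on U (b i) \<and> smooth_on U (e i) \<and>
         smooth_on U (f i) \<and> smooth_on U (g i) \<and>
         (\<forall>p\<in>U.
            partial i x p = a i p *\<^sub>R s p + b i p *\<^sub>R t p \<and>
            partial i n p = e i p *\<^sub>R s p + f i p *\<^sub>R t p \<and>
            partial i s p = a i p *\<^sub>R x p - e i p *\<^sub>R n p + g i p *\<^sub>R t p \<and>
            partial i t p = b i p *\<^sub>R x p - f i p *\<^sub>R n p - g i p *\<^sub>R s p))"


section \<open>Hyperbolic generalized framed surfaces\<close>

definition hyp_gen_framed_surface_with ::
    "(real^2) set \<Rightarrow> (real^2 \<Rightarrow> real^4) \<Rightarrow> (real^2 \<Rightarrow> real^4) \<Rightarrow> (real^2 \<Rightarrow> real^4) \<Rightarrow>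
     (real^2 \<Rightarrow> real) \<Rightarrow> (real^2 \<Rightarrow> real) \<Rightarrow> bool"
  where "hyp_gen_framed_surface_with U x \<nu>1 \<nu>2 \<alpha> \<beta> \<longleftrightarrow>
    smooth_H3_Delta5 U x \<nu>1 \<nu>2 \<and>
    (\<forall>p\<in>U. x p \<star> \<nu>1 p = 0 \<and> x p \<star> \<nu>2 p = 0) \<and>
    smooth_on U \<alpha> \<and> smooth_on U \<beta> \<and>
    (\<forall>p\<in>U. wedge (x p) (partial 1 x p) (partial 2 x p) = \<alpha> p *\<^sub>R \<nu>1 p + \<beta> p *\<^sub>R \<nu>2 p)"

definition hyp_gen_framed_surface ::
    "(real^2) set \<Rightarrow> (real^2 \<Rightarrow> real^4) \<Rightarrow> (real^2 \<Rightarrow> real^4) \<Rightarrow> (real^2 \<Rightarrow> real^4) \<Rightarrow> bool"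
  where "hyp_gen_framed_surface U x \<nu>1 \<nu>2 \<longleftrightarrow>
    (\<exists>\<alpha> \<beta>. hyp_gen_framed_surface_with U x \<nu>1 \<nu>2 \<alpha> \<beta>)"

definition hyp_gen_framed_invariants ::
    "(real^2) set \<Rightarrow> (real^2 \<Rightarrow> real^4) \<Rightarrow> (real^2 \<Rightarrow> real^4) \<Rightarrow> (real^2 \<Rightarrow> real^4) \<Rightarrow>
     (2 \<Rightarrow> real^2 \<Rightarrow> real) \<Rightarrow> (2 \<Rightarrow> real^2 \<Rightarrow> real) \<Rightarrow> (2 \<Rightarrow> real^2 \<Rightarrow> real) \<Rightarrow>
     (2 \<Rightarrow> real^2 \<Rightarrow> real) \<Rightarrow> (2 \<Rightarrow> real^2 \<Rightarrow> real) \<Rightarrow> (2 \<Rightarrow> real^2 \<Rightarrow> real) \<Rightarrow> bool"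
  where "hyp_gen_framed_invariants U x \<nu>1 \<nu>2 a b c e f g \<longleftrightarrow>
    (let \<nu>3 = (\<lambda>p. wedge (x p) (\<nu>1 p) (\<nu>2 p)) in
     \<forall>i. smooth_on U (a i) \<and> smooth_on U (b i) \<and> smooth_on U (c i) \<and>
         smooth_on U (e i) \<and> smooth_on U (f i) \<and> smooth_on U (g i) \<and>
         (\<forall>p\<in>U.
            partial i x p = a i p *\<^sub>R \<nu>1 p + b i p *\<^sub>R \<nu>2 p + c i p *\<^sub>R \<nu>3 p \<and>
            partial i \<nu>1 p = a i p *\<^sub>R x p + e i p *\<^sub>R \<nu>2 p + f i p *\<^sub>R \<nu>3 p \<and>
            partial i \<nu>2 p = b i p *\<^sub>R x p - e i p *\<^sub>R \<nu>1 p + g i p *\<^sub>R \<nu>3 p \<and>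
            partial i \<nu>3 p = c i p *\<^sub>R x p - f i p *\<^sub>R \<nu>1 p - g i p *\<^sub>R \<nu>2 p))"

end

theory Submission
  imports Defs
begin

text \<open>
  Everything happens in one moving frame. If \<open>n\<close> and \<open>s\<close> are orthonormal, spacelike and orthogonal
  to \<open>x \<in> H3\<close>, then \<open>x, n, s\<close> and \<open>t = wedge x n s\<close> form a pseudo-orthonormal frame of Minkowski
  space, and \<open>wedge x s t = n\<close> (\<open>wedge_wedge_frame\<close>). This last identity comes from the Lorentzian
  form of the Gram identity, \<open>mink_wedge_wedge\<close>.

  For a framed surface both partial derivatives of \<open>x\<close> lie in the plane spanned by \<open>s\<close> and \<open>t\<close>.
  Since \<open>wedge x\<close> is bilinear and alternating, \<open>wedge x (partial 1 x) (partial 2 x)\<close> is the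
  determinant of the two coordinate pairs times \<open>wedge x s t = n\<close>, hence has no component along
  \<open>s\<close>. The remaining demand of the definition, smoothness of that determinant, is the closure of
  \<open>smooth_on U\<close> under products and differences.

  Conversely, for a generalized framed surface the pairing of \<open>partial i x\<close> with \<open>\<nu>1\<close> is \<open>a i\<close>
  and that with \<open>\<nu>2\<close> is \<open>b i\<close>, so the condition that distinguishes framed surfaces is the
  vanishing of \<open>a\<close>, or of \<open>b\<close> once the roles of \<open>\<nu>1\<close> and \<open>\<nu>2\<close> are exchanged.
\<close>

section \<open>Pseudo inner product and pseudo vector product\<close>

lemma mink_commute: "x \<star> y = y \<star> x"
  by (simp add: mink_def mult.commute)

lemma mink_add_left: "(x + y) \<star> z = x \<star> z + y \<star> z"
  by (simp add: mink_def algebra_simps)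

lemma mink_scaleR_left: "(c *\<^sub>R x) \<star> z = c * (x \<star> z)"
  by (simp add: mink_def algebra_simps)

lemma mink_wedge: "w \<star> wedge x y z = det (vector [w, x, y, z] :: real^4^4)"
  using theI'[OF wedge_ex1[of x y z]] unfolding wedge_def by blast

lemma wedge_eqI:
  assumes "\<And>w. w \<star> p = det (vector [w, x, y, z] :: real^4^4)"
  shows "wedge x y z = p"
  unfolding wedge_def using assms wedge_ex1[of x y z] by (intro the1_equality) auto

text \<open>Laplace expansion along the first two rows: the determinant becomes a sum of six products of
  \<open>2 \<times> 2\<close> minors, which turns each identity for \<open>wedge\<close> into a polynomial identity in
  coordinates.\<close>

lemma det_4_rows:
  fixes w x y z :: "real^4"
  shows "det (vector [w, x, y, z] :: real^4^4) =
      (w$1 * x$2 - w$2 * x$1) * (y$3 * z$4 - y$4 * z$3)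
    - (w$1 * x$3 - w$3 * x$1) * (y$2 * z$4 - y$4 * z$2)
    + (w$1 * x$4 - w$4 * x$1) * (y$2 * z$3 - y$3 * z$2)
    + (w$2 * x$3 - w$3 * x$2) * (y$1 * z$4 - y$4 * z$1)
    - (w$2 * x$4 - w$4 * x$2) * (y$1 * z$3 - y$3 * z$1)
    + (w$3 * x$4 - w$4 * x$3) * (y$1 * z$2 - y$2 * z$1)"
proof -
  have f: "finite {2::4, 3, 4}" "(1::4) \<notin> {2, 3, 4}" "finite {3::4, 4}" "(2::4) \<notin> {3, 4}"
      "finite {4::4}" "(3::4) \<notin> {4}"
    by auto
  show ?thesis
    unfolding det_def UNIV_4 sum_over_permutations_insert[OF f(1,2)]
      sum_over_permutations_insert[OF f(3,4)] sum_over_permutations_insert[OF f(5,6)]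
      permutes_sing
    by (simp add: sign_swap_id permutation_swap_id sign_compose permutation_compose
        sign_id vector_4 algebra_simps)
qed

lemma wedge_components:
  "wedge x y z $ 1 = - det (vector [axis 1 1, x, y, z] :: real^4^4)"
  "wedge x y z $ 2 = det (vector [axis 2 1, x, y, z] :: real^4^4)"
  "wedge x y z $ 3 = det (vector [axis 3 1, x, y, z] :: real^4^4)"
  "wedge x y z $ 4 = det (vector [axis 4 1, x, y, z] :: real^4^4)"
  by (simp_all add: mink_wedge[symmetric]) (simp_all add: mink_def axis_def)

text \<open>The Gram identity. The sign is opposite to the Euclidean one because the product of two
  determinants of \<open>4\<close> vectors is minus the determinant of their pairings.\<close>

lemma mink_wedge_wedge:
  "wedge x y z \<star> wedge x' y' z' =
    - (x \<star> x' * (y \<star> y' * (z \<star> z') - y \<star> z' * (z \<star> y'))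
     - x \<star> y' * (y \<star> x' * (z \<star> z') - y \<star> z' * (z \<star> x'))
     + x \<star> z' * (y \<star> x' * (z \<star> y') - y \<star> y' * (z \<star> x')))"
  unfolding mink_def[of "wedge x y z"] wedge_components det_4_rows
  by (simp add: axis_def mink_def) algebra

lemma wedge_orthogonal:
  "x \<star> wedge x y z = 0" "y \<star> wedge x y z = 0" "z \<star> wedge x y z = 0"
  unfolding mink_wedge det_4_rows vector_4 by algebra+

text \<open>With \<open>t = wedge x n s\<close>, moving the last row of \<open>det (w, x, s, t)\<close> to the front and then
  exchanging \<open>w\<close> and \<open>x\<close>, an even permutation in total, turns it into \<open>t \<star> wedge x w s\<close>. This is
  a pairing of two wedge products, which the Gram identity evaluates to \<open>n \<star> w\<close>.\<close>

lemma wedge_wedge_frame: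
  assumes "x \<star> x = -1" "s \<star> s = 1" "x \<star> n = 0" "x \<star> s = 0" "n \<star> s = 0"
  shows "wedge x s (wedge x n s) = n"
proof (rule wedge_eqI)
  fix w
  have "det (vector [w, x, s, wedge x n s] :: real^4^4) = wedge x n s \<star> wedge x w s"
    unfolding mink_wedge det_4_rows by algebra
  also have "\<dots> = n \<star> w"
    using assms by (simp add: mink_wedge_wedge mink_commute[of s x] mink_commute[of n x])
  finally show "w \<star> n = det (vector [w, x, s, wedge x n s] :: real^4^4)"
    by (simp add: mink_commute)
qed

lemma wedge_combination:
  "wedge x (a *\<^sub>R s + b *\<^sub>R t) (c *\<^sub>R s + d *\<^sub>R t) = (a * d - c * b) *\<^sub>R wedge x s t"
proof (rule wedge_eqI)
  fix w
  have "w \<star> ((a * d - c * b) *\<^sub>R wedge x s t) = (a * d - c * b) * (w \<star> wedge x s t)"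
    by (metis mink_commute mink_scaleR_left)
  also have "\<dots> = det (vector [w, x, a *\<^sub>R s + b *\<^sub>R t, c *\<^sub>R s + d *\<^sub>R t] :: real^4^4)"
    unfolding mink_wedge det_4_rows by simp algebra
  finally show "w \<star> ((a * d - c * b) *\<^sub>R wedge x s t)
      = det (vector [w, x, a *\<^sub>R s + b *\<^sub>R t, c *\<^sub>R s + d *\<^sub>R t] :: real^4^4)" .
qed

section \<open>Algebra of smooth functions\<close>

lemma partial_has_vector_derivative:
  assumes "f differentiable (at p)"
  shows "((\<lambda>h. f (p + h *\<^sub>R axis i 1)) has_vector_derivative partial i f p) (at 0)"
proof -
  obtain D where D: "(f has_derivative D) (at (p + 0 *\<^sub>R axis i 1))"
    using assms by (auto simp: differentiable_def)
  have "((\<lambda>h. p + h *\<^sub>R axis i 1) has_derivative (\<lambda>h. h *\<^sub>R axis i 1)) (at (0::real))"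
    by (auto intro!: derivative_eq_intros)
  from has_derivative_compose[OF this D]
  have "(\<lambda>h. f (p + h *\<^sub>R axis i 1)) differentiable (at 0)"
    by (auto simp: differentiable_def)
  then show ?thesis
    unfolding partial_def by (simp add: vector_derivative_works)
qed

lemma partial_eqI:
  assumes "((\<lambda>h. f (p + h *\<^sub>R axis i 1)) has_vector_derivative D) (at 0)"
  shows "partial i f p = D"
  using assms unfolding partial_def by (rule vector_derivative_at)

lemma partial_cong:
  assumes "open U" "p \<in> U" "\<And>q. q \<in> U \<Longrightarrow> f q = g q"
  shows "partial i f p = partial i g p"
proof -
  have "((\<lambda>h. p + h *\<^sub>R axis i 1) \<longlongrightarrow> p + 0 *\<^sub>R axis i 1) (nhds (0::real))"
    by (intro tendsto_intros filterlim_ident)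
  then have "eventually (\<lambda>h. p + h *\<^sub>R axis i 1 \<in> U) (nhds (0::real))"
    using assms(1,2) by (auto dest: topological_tendstoD)
  then have "eventually (\<lambda>h. h \<in> UNIV \<longrightarrow> f (p + h *\<^sub>R axis i 1) = g (p + h *\<^sub>R axis i 1))
      (nhds (0::real))"
    by eventually_elim (simp add: assms(3))
  then show ?thesis
    unfolding partial_def by (intro vector_derivative_cong_eq) auto
qed

lemma Ck_on_cong:
  assumes "open U" "Ck_on k U f" "\<And>p. p \<in> U \<Longrightarrow> f p = g p"
  shows "Ck_on k U g"
  using assms(2,3)
proof (induction k arbitrary: f g)
  case 0
  then show ?case using continuous_on_cong by force
next
  case (Suc k)
  have "g differentiable (at p)" if "p \<in> U" for p
  proof -
    from Suc.prems(1) that obtain D where "(f has_derivative D) (at p)"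
      by (auto simp: differentiable_def)
    then have "(g has_derivative D) (at p)"
      using assms(1) that Suc.prems(2) by (rule has_derivative_transform_within_open)
    then show ?thesis by (auto simp: differentiable_def)
  qed
  moreover have "Ck_on k U (partial i g)" for i
  proof (rule Suc.IH)
    show "Ck_on k U (partial i f)" using Suc.prems(1) by simp
    show "partial i f p = partial i g p" if "p \<in> U" for p
      using assms(1) that Suc.prems(2) by (rule partial_cong)
  qed
  ultimately show ?case by simp
qed

lemma Ck_on_SucD: "Ck_on (Suc k) U f \<Longrightarrow> Ck_on k U f"
proof (induction k arbitrary: f)
  case 0
  then show ?case
    by (auto intro!: continuous_at_imp_continuous_on differentiable_imp_continuous_within)
next
  case (Suc k)
  then show ?case by (metis Ck_on.simps(2))
qed

lemma Ck_on_diff: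
  assumes "open U" "Ck_on k U f" "Ck_on k U g"
  shows "Ck_on k U (\<lambda>p. f p - g p)"
  using assms(2,3)
proof (induction k arbitrary: f g)
  case 0
  then show ?case by (simp add: continuous_on_diff)
next
  case (Suc k)
  have "Ck_on k U (partial i (\<lambda>p. f p - g p))" for i
  proof (rule Ck_on_cong[OF assms(1)])
    show "Ck_on k U (\<lambda>p. partial i f p - partial i g p)"
      using Suc by simp
    show "partial i f p - partial i g p = partial i (\<lambda>p. f p - g p) p" if "p \<in> U" for p
      using Suc.prems that
      by (intro partial_eqI[symmetric] has_vector_derivative_diff partial_has_vector_derivative)
        auto
  qed
  with Suc.prems show ?case by simp
qed

lemma Ck_on_add:
  assumes "open U" "Ck_on k U f" "Ck_on k U g"
  shows "Ck_on k U (\<lambda>p. f p + g p)"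
  using assms(2,3)
proof (induction k arbitrary: f g)
  case 0
  then show ?case by (simp add: continuous_on_add)
next
  case (Suc k)
  have "Ck_on k U (partial i (\<lambda>p. f p + g p))" for i
  proof (rule Ck_on_cong[OF assms(1)])
    show "Ck_on k U (\<lambda>p. partial i f p + partial i g p)"
      using Suc by simp
    show "partial i f p + partial i g p = partial i (\<lambda>p. f p + g p) p" if "p \<in> U" for p
      using Suc.prems that
      by (intro partial_eqI[symmetric] has_vector_derivative_add partial_has_vector_derivative)
        auto
  qed
  with Suc.prems show ?case by simp
qed

text \<open>The Leibniz rule expresses the partial derivatives of a product through \<open>f\<close> and \<open>g\<close>
  themselves, so the induction needs them one order lower as well (\<open>Ck_on_SucD\<close>).\<close>

lemma Ck_on_mult:
  fixes f g :: "real^2 \<Rightarrow> 'a::real_normed_algebra"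
  assumes "open U" "Ck_on k U f" "Ck_on k U g"
  shows "Ck_on k U (\<lambda>p. f p * g p)"
  using assms(2,3)
proof (induction k arbitrary: f g)
  case 0
  then show ?case by (simp add: continuous_on_mult)
next
  case (Suc k)
  have "Ck_on k U (partial i (\<lambda>p. f p * g p))" for i
  proof (rule Ck_on_cong[OF assms(1)])
    show "Ck_on k U (\<lambda>p. f p * partial i g p + partial i f p * g p)"
      using Suc.prems Suc.prems[THEN Ck_on_SucD] by (intro Ck_on_add[OF assms(1)] Suc.IH) auto
    show "f p * partial i g p + partial i f p * g p = partial i (\<lambda>p. f p * g p) p" if "p \<in> U" for p
    proof -
      have "((\<lambda>h. f (p + h *\<^sub>R axis i 1)) has_vector_derivative partial i f p) (at 0)"
        "((\<lambda>h. g (p + h *\<^sub>R axis i 1)) has_vector_derivative partial i g p) (at 0)"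
        using Suc.prems that by (auto intro: partial_has_vector_derivative)
      from has_vector_derivative_mult[OF this] show ?thesis
        by (intro partial_eqI[symmetric]) simp
    qed
  qed
  with Suc.prems show ?case by simp
qed

lemma Ck_on_const: "Ck_on k U (\<lambda>p. c)"
proof (induction k arbitrary: c)
  case (Suc k)
  have "partial i (\<lambda>p. c) = (\<lambda>p. 0)" for i
    by (rule ext) (simp add: partial_def)
  then show ?case using Suc by simp
qed simp

section \<open>Framed and generalized framed surfaces\<close>

lemma smooth_H3_Delta5_swap:
  "smooth_H3_Delta5 U x m n \<Longrightarrow> smooth_H3_Delta5 U x n m"
  by (auto simp: smooth_H3_Delta5_def Delta5_def mink_commute)

lemma hyp_framed_imp_gen_framed:
  assumes "open U" "hyp_framed_surface U x n s" "hyp_framed_invariants U x n s a b e f g"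
  shows "hyp_gen_framed_surface_with U x n s (\<lambda>p. a 1 p * b 2 p - a 2 p * b 1 p) (\<lambda>p. 0)"
proof -
  note inv = assms(3)[unfolded hyp_framed_invariants_def Let_def]
  have smooth: "smooth_on U (\<lambda>p. a 1 p * b 2 p - a 2 p * b 1 p)"
    using inv assms(1) unfolding smooth_on_def by (auto intro!: Ck_on_diff Ck_on_mult)
  have "wedge (x p) (partial 1 x p) (partial 2 x p)
      = (a 1 p * b 2 p - a 2 p * b 1 p) *\<^sub>R n p + 0 *\<^sub>R s p" if p: "p \<in> U" for p
  proof -
    have xu: "partial i x p = a i p *\<^sub>R s p + b i p *\<^sub>R wedge (x p) (n p) (s p)" for i
      using inv p by blast
    have "wedge (x p) (s p) (wedge (x p) (n p) (s p)) = n p"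
      using assms(2) p
      by (intro wedge_wedge_frame)
        (auto simp: hyp_framed_surface_def smooth_H3_Delta5_def H3_def Delta5_def S31_def)
    then show ?thesis
      by (simp add: xu wedge_combination)
  qed
  with smooth assms(2) show ?thesis
    by (auto simp: hyp_gen_framed_surface_with_def hyp_framed_surface_def smooth_on_def Ck_on_const)
qed

lemma gen_framed_partial_mink:
  assumes "hyp_gen_framed_surface U x \<nu>1 \<nu>2"
    and "hyp_gen_framed_invariants U x \<nu>1 \<nu>2 a b c e f g" and "p \<in> U"
  shows "partial i x p \<star> \<nu>1 p = a i p" "partial i x p \<star> \<nu>2 p = b i p"
proof -
  have "\<nu>1 p \<star> \<nu>1 p = 1" "\<nu>2 p \<star> \<nu>2 p = 1" "\<nu>1 p \<star> \<nu>2 p = 0"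
    using assms(1,3)
    by (auto simp: hyp_gen_framed_surface_def hyp_gen_framed_surface_with_def
        smooth_H3_Delta5_def Delta5_def S31_def)
  moreover have "partial i x p
      = a i p *\<^sub>R \<nu>1 p + b i p *\<^sub>R \<nu>2 p + c i p *\<^sub>R wedge (x p) (\<nu>1 p) (\<nu>2 p)"
    using assms(2,3) unfolding hyp_gen_framed_invariants_def Let_def by blast
  ultimately show "partial i x p \<star> \<nu>1 p = a i p" "partial i x p \<star> \<nu>2 p = b i p"
    by (simp_all add: mink_add_left mink_scaleR_left mink_commute[of "\<nu>2 p" "\<nu>1 p"]
        mink_commute[of "wedge _ _ _"] wedge_orthogonal)
qed

theorem proposition3p5:
  fixes U :: "(real^2) set"
  assumes "open U" and "simply_connected U"
  shows
    "(\<forall>x n s a b e f g.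
        hyp_framed_surface U x n s \<and> hyp_framed_invariants U x n s a b e f g \<longrightarrow>
        hyp_gen_framed_surface_with U x n s (\<lambda>p. a 1 p * b 2 p - a 2 p * b 1 p) (\<lambda>p. 0))
     \<and>
     (\<forall>x \<nu>1 \<nu>2 a b c e f g.
        hyp_gen_framed_surface U x \<nu>1 \<nu>2 \<and> hyp_gen_framed_invariants U x \<nu>1 \<nu>2 a b c e f g \<longrightarrow>
        ((\<forall>p\<in>U. a 1 p = 0 \<and> a 2 p = 0) \<longrightarrow> hyp_framed_surface U x \<nu>1 \<nu>2) \<and>
        ((\<forall>p\<in>U. b 1 p = 0 \<and> b 2 p = 0) \<longrightarrow> hyp_framed_surface U x \<nu>2 \<nu>1))"
proof (intro conjI allI impI; elim conjE)
  fix x n s a b e f g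
  assume "hyp_framed_surface U x n s" "hyp_framed_invariants U x n s a b e f g"
  then show "hyp_gen_framed_surface_with U x n s (\<lambda>p. a 1 p * b 2 p - a 2 p * b 1 p) (\<lambda>p. 0)"
    by (rule hyp_framed_imp_gen_framed[OF assms(1)])
next
  fix x \<nu>1 \<nu>2 a b c e f g
  assume gen: "hyp_gen_framed_surface U x \<nu>1 \<nu>2"
    and inv: "hyp_gen_framed_invariants U x \<nu>1 \<nu>2 a b c e f g"
  have base: "smooth_H3_Delta5 U x \<nu>1 \<nu>2" "\<forall>p\<in>U. x p \<star> \<nu>1 p = 0 \<and> x p \<star> \<nu>2 p = 0"
    using gen by (auto simp: hyp_gen_framed_surface_def hyp_gen_framed_surface_with_def)
  note pairings = gen_framed_partial_mink[OF gen inv]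
  show "hyp_framed_surface U x \<nu>1 \<nu>2" if "\<forall>p\<in>U. a 1 p = 0 \<and> a 2 p = 0"
    using that base by (simp add: hyp_framed_surface_def pairings)
  show "hyp_framed_surface U x \<nu>2 \<nu>1" if "\<forall>p\<in>U. b 1 p = 0 \<and> b 2 p = 0"
    using that base by (simp add: hyp_framed_surface_def pairings smooth_H3_Delta5_swap)
qed

end
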